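(* For each regular thread $p$, there exist an $n\in\mathbb N$ and a closed PGA term $P$ in which jump instructions do not occur such that $p$ is the thread denoted by $$\Bigl(\bigl(\bigl(\bigl(\ldots(|P| \,/_{\mathsf{st}:1}\, BR_{\mathsf F})\ldots /_{\mathsf{st}:n+2}\, BR_{\mathsf F}\bigr) /_{\mathsf{rt}}\, BR_{\mathsf F}\bigr) /_{\mathsf{rf}}\, BR_{\mathsf F}\bigr) /_{\mathsf{en}}\, BR_{\mathsf F}\Bigr) /_{\mathsf{sk}}\, BR_{\mathsf F}.$$
   Context: Foci, methods, actions. Fix a set $\mathcal F$ of foci and a set $\mathcal M$ of methods, and let $\mathcal A=\{f.m\mid f\in\mathcal F,m\in\mathcal M\}$ be the set of basic actions. Among the foci are $\mathsf{st}{:}j$ ($j\ge1$), $\mathsf{rt}$, $\mathsf{rf}$, $\mathsf{en}$, $\mathsf{sk}$ (differently written foci are different), which serve as names of Boolean registers; among the methods are $\mathsf{set{:}T}$, $\mathsf{set{:}F}$, $\mathsf{get}$. Basic thread algebra (BTA). One sort of threads, with constants $\mathsf D$ (deadlock), $\mathsf S$ (termination), and for each $a\in\mathcal A$ a binary operator $x\unlhd a\unrhd y$ (perform $a$; proceed as $x$ on reply $\mathsf T$ and as $y$ on reply $\mathsf F$). The abbreviation $a\circ p$ stands for $p\unlhd a\unrhd p$. A guarded recursive specification is a set of equations $E=\{X=t_X\mid X\in V\}$, where $V$ is a set of variables and each $t_X$ is $\mathsf D$, $\mathsf S$ or of the form $t\unlhd a\unrhd t'$, with only variables from $V$. The constant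 $\langle X|E\rangle$ denotes the unique solution of $E$ for $X$. Axioms: RDP, $\langle X|E\rangle=t_X[\langle Y|E\rangle/Y]_{Y\in V}$; RSP, $E\Rightarrow X=\langle X|E\rangle$. The projection operators $\pi_n$ ($n\in\mathbb N$) satisfy $\pi_0(x)=\mathsf D$, $\pi_{n+1}(\mathsf S)=\mathsf S$, $\pi_{n+1}(\mathsf D)=\mathsf D$, $\pi_{n+1}(x\unlhd a\unrhd y)=\pi_n(x)\unlhd a\unrhd\pi_n(y)$, and AIP: if $\pi_n(x)=\pi_n(y)$ for all $n\ge0$ then $x=y$. Services and use operators. A service is $H=(S,\mathit{eff},\mathit{yld},s_0)$ with $\mathit{eff}:\mathcal M\times S\to S$, $\mathit{yld}:\mathcal M\times S\to\{\mathsf T,\mathsf F,\mathsf B\}$, $s_0\in S$, such that $\mathit{yld}(m,s)=\mathsf B$ implies $\mathit{yld}(m',\mathit{eff}(m,s))=\mathsf B$ for all $m'$. Put $\frac{\partial}{\partial m}H=(S,\mathit{eff},\mathit{yld},\mathit{eff}(m,s_0))$ and $H(m)=\mathit{yld}(m,s_0)$. For each $f\in\mathcal F$ the use operator $x/_fH$ (thread $x$, service $H$, result a thread) satisfies: $\mathsf S/_fH=\mathsf S$; $\mathsf D/_fH=\mathsf D$; $(x\unlhd g.m\unrhd y)/_fH=(x/_fH)\unlhd g.m\unrhd(y/_fH)$ if $f\ne g$; $(x\unlhd f.m\unrhd y)/_fH$ equals $x/_f\frac{\partial}{\partial m}H$ if $H(m)=\mathsf T$, $y/_f\frac{\partial}{\partial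 m}H$ if $H(m)=\mathsf F$, and $\mathsf D$ if $H(m)=\mathsf B$; and if $\pi_n(x)/_fH=\pi_n(y)/_fH$ for all $n\ge0$ then $x/_fH=y/_fH$. Boolean registers. For $s\in\{\mathsf T,\mathsf F,\mathsf B\}$, $BR_s=(\{\mathsf T,\mathsf F,\mathsf B\},\mathit{eff},\mathit{eff},s)$ (effect and yield coincide), where for $b\in\{\mathsf T,\mathsf F\}$: $\mathit{eff}(\mathsf{set{:}T},b)=\mathsf T$, $\mathit{eff}(\mathsf{set{:}F},b)=\mathsf F$, $\mathit{eff}(\mathsf{get},b)=b$, $\mathit{eff}(m,b)=\mathsf B$ for every other method $m$, and $\mathit{eff}(m,\mathsf B)=\mathsf B$ for all $m$. Model and regular threads. Fix an arbitrary model $\mathfrak M$ of BTA extended with guarded recursion and the use operators (satisfying the axioms above), in which guarded recursive specifications have unique solutions. A thread is an element of the thread domain of $\mathfrak M$. For a thread $p$, $\mathrm{Res}(p)$ is the least set with $p\in\mathrm{Res}(p)$ and: if $q\unlhd a\unrhd r\in\mathrm{Res}(p)$ then $q\in\mathrm{Res}(p)$ and $r\in\mathrm{Res}(p)$. The thread $p$ is regular if $\mathrm{Res}(p)$ is finite. Program algebra (PGA). The set $\mathcal A$ is also used as the set of basic instructions. Primitive instructions: $a$, $+a$, $-a$ for $a\in\mathcal A$; forward jumps $\#l$ for $l\in\mathbb N$; termination $!$. Closed PGA terms are built from primitive instructions by concatenation $X;Y$ and repetition $X^\omega$; they denote non-empty finite or eventually periodic infinite instruction sequences ($X^\omega$ is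 $X$ repeated forever, and $X^\omega;Y=X^\omega$), and terms denoting the same sequence are identified. Thread extraction $|\cdot|$ assigns to each closed PGA term a thread, by: $|a|=|{+a}|=|{-a}|=a\circ\mathsf D$; $|a;X|=a\circ|X|$; $|{+a};X|=|X|\unlhd a\unrhd|\#2;X|$; $|{-a};X|=|\#2;X|\unlhd a\unrhd|X|$; $|\#l|=\mathsf D$; $|\#0;X|=\mathsf D$; $|\#1;X|=|X|$; $|\#(l+2);u|=\mathsf D$; $|\#(l+2);u;X|=|\#(l+1);X|$ ($u$ a primitive instruction); $|!|=|!;X|=\mathsf S$; and $|\#l;X|=\mathsf D$ if $\#l$ begins an infinite chain of jumps. For sequences with repetition these equations yield a finite guarded recursive specification, whose solution is the extracted thread.
   Formalization: Added: each residual thread of p is D, S or x⊴a⊵y with a not on a focus st:j, rt, rf, en, sk. Otherwise false: S⊴rt.get⊵D is regular but not denotable in the projective limit model (/rt removes all rt actions), and models may contain regular junk elements. *)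

theory Defs
  imports Main "HOL-Library.Extended_Nat"
begin

datatype reply = ReplyT | ReplyF | ReplyB

record ('m, 's) service =
  states :: "'s set"
  eff :: "'m \<Rightarrow> 's \<Rightarrow> 's"
  yld :: "'m \<Rightarrow> 's \<Rightarrow> reply"
  init :: 's

definition is_service :: "('m, 's) service \<Rightarrow> bool" where
  "is_service H \<longleftrightarrow>
     init H \<in> states H \<and>
     (\<forall>m. \<forall>s \<in> states H. eff H m s \<in> states H) \<and>
     (\<forall>m. \<forall>s \<in> states H. yld H m s = ReplyB \<longrightarrow> (\<forall>m'. yld H m' (eff H m s) = ReplyB))"

definition derived :: "'m \<Rightarrow> ('m, 's) service \<Rightarrow> ('m, 's) service" where
  "derived m H = H\<lparr>init := eff H m (init H)\<rparr>"

definition reply_of :: "('m, 's) service \<Rightarrow> 'm \<Rightarrow> reply" where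
  "reply_of H m = yld H m (init H)"

fun br_eff :: "'m \<Rightarrow> 'm \<Rightarrow> 'm \<Rightarrow> 'm \<Rightarrow> reply \<Rightarrow> reply" where
  "br_eff set_T set_F get m ReplyB = ReplyB"
| "br_eff set_T set_F get m b =
     (if m = set_T then ReplyT else if m = set_F then ReplyF else if m = get then b else ReplyB)"

text \<open>Services in one model draw their states from one universe type. Taking it to be
  \<open>reply + 's\<close>, with \<open>'s\<close> arbitrary, puts the state set of the Boolean registers (the
  left summand) into it. The values of the two functions outside the state set play no role.\<close>

definition bool_reg :: "'m \<Rightarrow> 'm \<Rightarrow> 'm \<Rightarrow> reply \<Rightarrow> ('m, reply + 's) service" where
  "bool_reg set_T set_F get s =
     \<lparr>states = range Inl,
      eff = (\<lambda>m x. Inl (br_eff set_T set_F get m (projl x))),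
      yld = (\<lambda>m x. br_eff set_T set_F get m (projl x)),
      init = Inl s\<rparr>"

datatype (acts: 'a, vars: 'v) bta_term =
  Var 'v | DeadT | StopT | PccT "('a, 'v) bta_term" 'a "('a, 'v) bta_term"

lemma is_service_bool_reg: "is_service (bool_reg set_T set_F get s)"
  by (auto simp: is_service_def bool_reg_def)

text \<open>A set of equations \<open>{X = t\<^sub>X | X \<in> V}\<close> is a partial map with domain \<open>V\<close>.\<close>

type_synonym 'a spec = "nat \<rightharpoonup> ('a, nat) bta_term"

definition guarded :: "'a spec \<Rightarrow> bool" where
  "guarded E \<longleftrightarrow> (\<forall>X t. E X = Some t \<longrightarrow>
     (t = DeadT \<or> t = StopT \<or> (\<exists>t1 a t2. t = PccT t1 a t2)) \<and> vars t \<subseteq> dom E)"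

text \<open>The basic action \<open>f.m\<close> is the pair \<open>(f, m)\<close>; \<open>pcc M x a y\<close> is the postconditional
  composition that performs \<open>a\<close> and proceeds as \<open>x\<close> on reply T and as \<open>y\<close> on reply F;
  \<open>rec M E X\<close> interprets the constant \<open>\<langle>X|E\<rangle>\<close>. The thread domain is the type \<open>'p\<close>.\<close>

record ('f, 'm, 's, 'p) bta =
  dead :: 'p
  stop :: 'p
  pcc :: "'p \<Rightarrow> 'f \<times> 'm \<Rightarrow> 'p \<Rightarrow> 'p"
  rec :: "('f \<times> 'm) spec \<Rightarrow> nat \<Rightarrow> 'p"
  proj :: "nat \<Rightarrow> 'p \<Rightarrow> 'p"
  use :: "'f \<Rightarrow> 'p \<Rightarrow> ('m, 's) service \<Rightarrow> 'p"

primrec interp :: "('f, 'm, 's, 'p) bta \<Rightarrow> ('v \<Rightarrow> 'p) \<Rightarrow> ('f \<times> 'm, 'v) bta_term \<Rightarrow> 'p" where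
  "interp M \<sigma> (Var X) = \<sigma> X"
| "interp M \<sigma> DeadT = dead M"
| "interp M \<sigma> StopT = stop M"
| "interp M \<sigma> (PccT t a u) = pcc M (interp M \<sigma> t) a (interp M \<sigma> u)"

locale bta_model =
  fixes M :: "('f, 'm, 's, 'p) bta"
  assumes RDP: "guarded E \<Longrightarrow> E X = Some t \<Longrightarrow> rec M E X = interp M (rec M E) t"
    and RSP: "guarded E \<Longrightarrow> (\<And>Y t. E Y = Some t \<Longrightarrow> \<sigma> Y = interp M \<sigma> t) \<Longrightarrow>
      X \<in> dom E \<Longrightarrow> \<sigma> X = rec M E X"
    and proj_0: "proj M 0 x = dead M"
    and proj_stop: "proj M (Suc n) (stop M) = stop M"
    and proj_dead: "proj M (Suc n) (dead M) = dead M"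
    and proj_pcc: "proj M (Suc n) (pcc M x a y) = pcc M (proj M n x) a (proj M n y)"
    and AIP: "(\<And>n. proj M n x = proj M n y) \<Longrightarrow> x = y"
    and use_stop: "is_service H \<Longrightarrow> use M f (stop M) H = stop M"
    and use_dead: "is_service H \<Longrightarrow> use M f (dead M) H = dead M"
    and use_other: "is_service H \<Longrightarrow> f \<noteq> g \<Longrightarrow>
      use M f (pcc M x (g, m) y) H = pcc M (use M f x H) (g, m) (use M f y H)"
    and use_T: "is_service H \<Longrightarrow> reply_of H m = ReplyT \<Longrightarrow>
      use M f (pcc M x (f, m) y) H = use M f x (derived m H)"
    and use_F: "is_service H \<Longrightarrow> reply_of H m = ReplyF \<Longrightarrow>
      use M f (pcc M x (f, m) y) H = use M f y (derived m H)"
    and use_B: "is_service H \<Longrightarrow> reply_of H m = ReplyB \<Longrightarrow>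
      use M f (pcc M x (f, m) y) H = dead M"
    and use_proj: "is_service H \<Longrightarrow>
      (\<And>n. use M f (proj M n x) H = use M f (proj M n y) H) \<Longrightarrow> use M f x H = use M f y H"

inductive_set Res :: "('f, 'm, 's, 'p) bta \<Rightarrow> 'p \<Rightarrow> 'p set"
  for M :: "('f, 'm, 's, 'p) bta" and p :: 'p where
  self: "p \<in> Res M p"
| left: "pcc M q a r \<in> Res M p \<Longrightarrow> q \<in> Res M p"
| right: "pcc M q a r \<in> Res M p \<Longrightarrow> r \<in> Res M p"

definition regular :: "('f, 'm, 's, 'p) bta \<Rightarrow> 'p \<Rightarrow> bool" where
  "regular M p \<longleftrightarrow> finite (Res M p)"

text \<open>\<open>p\<close> is a thread whose basic actions are all in \<open>A\<close>. The axioms do not force every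
  element of the thread domain to be D, S or a postconditional composition, so this is
  required of the residual threads too. In a model without such elements, and with unique
  decomposition, it says that no action outside \<open>A\<close> occurs in \<open>p\<close>. A use operator for the
  focus \<open>f\<close> eliminates all actions of focus \<open>f\<close>, so only threads without actions on the
  register foci can be denoted by applying use operators for these foci.\<close>

definition thread_over :: "('f, 'm, 's, 'p) bta \<Rightarrow> ('f \<times> 'm) set \<Rightarrow> 'p \<Rightarrow> bool" where
  "thread_over M A p \<longleftrightarrow> (\<forall>q \<in> Res M p.
     q = dead M \<or> q = stop M \<or> (\<exists>x y. \<exists>a \<in> A. q = pcc M x a y))"

datatype 'a instr = Basic 'a | PosTest 'a | NegTest 'a | Jump nat | Halt

datatype (instrs: 'i) pga = Prim 'i | Concat "'i pga" "'i pga" | Repeat "'i pga"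

text \<open>\<open>len P\<close> and \<open>instr_at P i\<close> (\<open>i < len P\<close>, counting from 0) give the instruction
  sequence denoted by \<open>P\<close>; in particular \<open>X\<^sup>\<omega>;Y\<close> and \<open>(X\<^sup>\<omega>)\<^sup>\<omega>\<close> denote the same sequence
  as \<open>X\<^sup>\<omega>\<close>.\<close>

primrec len :: "'i pga \<Rightarrow> enat" where
  "len (Prim u) = 1"
| "len (Concat X Y) = len X + len Y"
| "len (Repeat X) = \<infinity>"

primrec instr_at :: "'i pga \<Rightarrow> nat \<Rightarrow> 'i" where
  "instr_at (Prim u) i = u"
| "instr_at (Concat X Y) i =
     (if enat i < len X then instr_at X i else instr_at Y (i - the_enat (len X)))"
| "instr_at (Repeat X) i =
     (if len X = \<infinity> then instr_at X i else instr_at X (i mod the_enat (len X)))"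

definition jump_free :: "'a instr pga \<Rightarrow> bool" where
  "jump_free P \<longleftrightarrow> (\<forall>l. Jump l \<notin> instrs P)"

text \<open>\<open>lands P i j\<close>: execution arriving at position \<open>i\<close> reaches, by a finite chain of jumps,
  the instruction at position \<open>j\<close>, which is not a jump. There is no such \<open>j\<close> if the chain
  is infinite, contains \<open>#0\<close> or leaves the sequence.\<close>

inductive lands :: "'a instr pga \<Rightarrow> nat \<Rightarrow> nat \<Rightarrow> bool" for P where
  here: "enat i < len P \<Longrightarrow> (\<And>l. instr_at P i \<noteq> Jump l) \<Longrightarrow> lands P i i"
| jump: "enat i < len P \<Longrightarrow> instr_at P i = Jump (Suc l) \<Longrightarrow> lands P (i + Suc l) j \<Longrightarrow> lands P i j"

definition instr_term :: "'a instr \<Rightarrow> nat \<Rightarrow> ('a, nat) bta_term" where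
  "instr_term u j = (case u of
     Basic a \<Rightarrow> PccT (Var (j + 1)) a (Var (j + 1))
   | PosTest a \<Rightarrow> PccT (Var (j + 1)) a (Var (j + 2))
   | NegTest a \<Rightarrow> PccT (Var (j + 2)) a (Var (j + 1))
   | Jump l \<Rightarrow> DeadT
   | Halt \<Rightarrow> StopT)"

text \<open>The guarded recursive specification that the thread extraction equations yield:
  variable \<open>i\<close> stands for the thread extracted from the suffix that starts at position \<open>i\<close>
  (D beyond the end). The extraction equations themselves are derived below.\<close>

definition extr_spec :: "'a instr pga \<Rightarrow> 'a spec" where
  "extr_spec P i = Some (if \<exists>j. lands P i j
     then let j = (THE j. lands P i j) in instr_term (instr_at P j) j
     else DeadT)"

definition thread_of :: "('f, 'm, 's, 'p) bta \<Rightarrow> ('f \<times> 'm) instr pga \<Rightarrow> 'p" where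
  "thread_of M P = rec M (extr_spec P) 0"

lemma lands_det: "lands P i j \<Longrightarrow> lands P i k \<Longrightarrow> j = k"
proof (induction rule: lands.induct)
  case (here i)
  from here(3) show ?case by cases (use here in auto)
next
  case (jump i l j)
  from jump.prems show ?case by cases (use jump in auto)
qed

lemma extr_spec_lands: "lands P i j \<Longrightarrow> extr_spec P i = Some (instr_term (instr_at P j) j)"
  using the_equality[of "lands P i" j] lands_det[of P i]
  by (metis extr_spec_def)

lemma extr_spec_none: "(\<And>j. \<not> lands P i j) \<Longrightarrow> extr_spec P i = Some DeadT"
  by (simp add: extr_spec_def)

lemma dom_extr_spec: "dom (extr_spec P) = UNIV"
  by (auto simp: extr_spec_def)

lemma guarded_extr_spec: "guarded (extr_spec P)"
  unfolding guarded_def dom_extr_spec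
  by (auto simp: extr_spec_def Let_def instr_term_def split: instr.splits if_splits)

text \<open>\<open>suffix_eq P k Q\<close>: \<open>Q\<close> denotes the suffix of \<open>P\<close> from position \<open>k\<close> on.\<close>

definition suffix_eq :: "'i pga \<Rightarrow> nat \<Rightarrow> 'i pga \<Rightarrow> bool" where
  "suffix_eq P k Q \<longleftrightarrow> (\<forall>i. (enat (k + i) < len P \<longleftrightarrow> enat i < len Q) \<and>
     (enat i < len Q \<longrightarrow> instr_at P (k + i) = instr_at Q i))"

lemma suffix_eq_lands_iff:
  assumes "suffix_eq P k Q"
  shows "lands P (k + i) j \<longleftrightarrow> (\<exists>j'. j = k + j' \<and> lands Q i j')"
proof
  have "lands P i0 j \<Longrightarrow> i0 = k + i \<Longrightarrow> \<exists>j'. j = k + j' \<and> lands Q i j'" for i0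
  proof (induction arbitrary: i rule: lands.induct)
    case (here i0)
    then show ?case using assms unfolding suffix_eq_def by (metis lands.here)
  next
    case (jump i0 l j)
    then obtain j' where "j = k + j'" "lands Q (i + Suc l) j'" by force
    with jump assms show ?case unfolding suffix_eq_def by (metis lands.jump)
  qed
  then show "lands P (k + i) j \<Longrightarrow> \<exists>j'. j = k + j' \<and> lands Q i j'" by blast
next
  have "lands Q i j' \<Longrightarrow> lands P (k + i) (k + j')" for j'
  proof (induction rule: lands.induct)
    case (here i)
    then show ?case using assms unfolding suffix_eq_def by (metis lands.here)
  next
    case (jump i l j)
    then show ?case using assms unfolding suffix_eq_def
      by (metis lands.jump add.assoc)
  qed
  then show "\<exists>j'. j = k + j' \<and> lands Q i j' \<Longrightarrow> lands P (k + i) j" by blast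
qed

lemma len_pos: "enat 0 < len P"
  by (induction P) (auto simp: enat_0 add_nonneg_pos)

context bta_model
begin

lemma rec_suffix:
  assumes "suffix_eq P k Q"
  shows "rec M (extr_spec P) (k + i) = rec M (extr_spec Q) i"
proof (rule RSP[OF guarded_extr_spec, where \<sigma> = "\<lambda>i. rec M (extr_spec P) (k + i)"])
  show "i \<in> dom (extr_spec Q)" by (simp add: dom_extr_spec)
  fix Y t assume Y: "extr_spec Q Y = Some t"
  show "rec M (extr_spec P) (k + Y) = interp M (\<lambda>i. rec M (extr_spec P) (k + i)) t"
  proof (cases "\<exists>j. lands Q Y j")
    case True
    then obtain j where j: "lands Q Y j" by blast
    then have "lands P (k + Y) (k + j)" using suffix_eq_lands_iff[OF assms] by blast
    then have "rec M (extr_spec P) (k + Y) =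
        interp M (rec M (extr_spec P)) (instr_term (instr_at P (k + j)) (k + j))"
      by (intro RDP guarded_extr_spec extr_spec_lands)
    moreover have "enat j < len Q" using j by induction auto
    then have "instr_at P (k + j) = instr_at Q j" using assms by (simp add: suffix_eq_def)
    moreover have "t = instr_term (instr_at Q j) j" using extr_spec_lands[OF j] Y by simp
    ultimately show ?thesis by (simp add: instr_term_def split: instr.splits)
  next
    case False
    then have "\<not> lands P (k + Y) j" for j using suffix_eq_lands_iff[OF assms] by blast
    then have "rec M (extr_spec P) (k + Y) = interp M (rec M (extr_spec P)) DeadT"
      by (intro RDP guarded_extr_spec extr_spec_none)
    moreover have "t = DeadT" using False Y extr_spec_none[of Q Y] by auto
    ultimately show ?thesis by simp
  qed
qed

lemma thread_of_suffix: "suffix_eq P k Q \<Longrightarrow> rec M (extr_spec P) k = thread_of M Q"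
  using rec_suffix[of P k Q 0] by (simp add: thread_of_def)

lemma thread_of_same_sequence:
  assumes "len P = len Q" "\<And>i. enat i < len P \<Longrightarrow> instr_at P i = instr_at Q i"
  shows "thread_of M P = thread_of M Q"
  using thread_of_suffix[of P 0 Q] assms by (simp add: suffix_eq_def thread_of_def)

lemma rec_beyond:
  assumes "\<not> enat i < len P" shows "rec M (extr_spec P) i = dead M"
proof -
  have "\<not> lands P i j" for j using assms by (auto elim: lands.cases)
  then show ?thesis using RDP[OF guarded_extr_spec extr_spec_none, of P i] by simp
qed

lemma rec_nonjump:
  assumes "enat i < len P" "\<And>l. instr_at P i \<noteq> Jump l"
  shows "rec M (extr_spec P) i =
    interp M (rec M (extr_spec P)) (instr_term (instr_at P i) i)"
  by (intro RDP guarded_extr_spec extr_spec_lands lands.here assms)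

lemma rec_jump_0:
  assumes "instr_at P i = Jump 0" shows "rec M (extr_spec P) i = dead M"
proof -
  have "\<not> lands P i j" for j using assms by (auto elim: lands.cases)
  then show ?thesis using RDP[OF guarded_extr_spec extr_spec_none, of P i] by simp
qed

lemma rec_jump_Suc:
  assumes "enat i < len P" "instr_at P i = Jump (Suc l)"
  shows "rec M (extr_spec P) i = rec M (extr_spec P) (i + Suc l)"
proof -
  have "lands P i j \<longleftrightarrow> lands P (i + Suc l) j" for j
    using assms by (auto elim: lands.cases intro: lands.jump)
  then have "lands P i = lands P (i + Suc l)" by blast
  then have "extr_spec P i = extr_spec P (i + Suc l)" by (simp only: extr_spec_def)
  moreover obtain t where "extr_spec P i = Some t" by (simp only: extr_spec_def)
  ultimately show ?thesis using RDP[OF guarded_extr_spec] by metis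
qed

lemma suffix_Prim: "suffix_eq (Concat (Prim u) X) (Suc 0) X"
  by (auto simp: suffix_eq_def one_enat_def the_enat.simps) (cases "len X"; simp)+

lemma rec_first:
  assumes "\<And>l. u \<noteq> Jump l"
  shows "rec M (extr_spec (Concat (Prim u) X)) 0 =
    interp M (rec M (extr_spec (Concat (Prim u) X))) (instr_term u 0)"
  using rec_nonjump[of 0 "Concat (Prim u) X", OF len_pos] assms by (simp add: one_enat_def)

lemma thread_of_Prim:
  "thread_of M (Prim (Basic a)) = pcc M (dead M) a (dead M)"
  "thread_of M (Prim (PosTest a)) = pcc M (dead M) a (dead M)"
  "thread_of M (Prim (NegTest a)) = pcc M (dead M) a (dead M)"
  "thread_of M (Prim Halt) = stop M"
  by (simp_all add: thread_of_def rec_nonjump rec_beyond len_pos instr_term_def one_enat_def)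

lemma thread_of_Prim_Jump: "thread_of M (Prim (Jump l)) = dead M"
  by (cases l) (simp_all add: thread_of_def rec_jump_0 rec_jump_Suc rec_beyond one_enat_def)

lemma thread_of_Basic:
  "thread_of M (Concat (Prim (Basic a)) X) = pcc M (thread_of M X) a (thread_of M X)"
  using thread_of_suffix[OF suffix_Prim, of "Basic a" X]
  by (simp add: thread_of_def rec_first instr_term_def)

lemma thread_of_Halt: "thread_of M (Concat (Prim Halt) X) = stop M"
  by (simp add: thread_of_def rec_first instr_term_def)

lemma thread_of_Jump_0: "thread_of M (Concat (Prim (Jump 0)) X) = dead M"
  by (simp add: thread_of_def rec_jump_0 one_enat_def)

lemma thread_of_Jump_Suc:
  "thread_of M (Concat (Prim (Jump (Suc l))) X) = rec M (extr_spec X) l"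
  using rec_suffix[OF suffix_Prim, of "Jump (Suc l)" X l]
    rec_jump_Suc[of 0 "Concat (Prim (Jump (Suc l))) X" l, OF len_pos]
  by (simp add: thread_of_def one_enat_def)

lemma thread_of_Jump_1: "thread_of M (Concat (Prim (Jump 1)) X) = thread_of M X"
  using thread_of_Jump_Suc[of 0 X] by (simp add: thread_of_def)

lemma thread_of_Jump_end: "thread_of M (Concat (Prim (Jump (l + 2))) (Prim u)) = dead M"
  by (simp add: thread_of_Jump_Suc rec_beyond one_enat_def)

lemma thread_of_Jump_skip:
  "thread_of M (Concat (Prim (Jump (l + 2))) (Concat (Prim u) X)) =
   thread_of M (Concat (Prim (Jump (l + 1))) X)"
  using rec_suffix[OF suffix_Prim, of u X l] by (simp add: thread_of_Jump_Suc)

lemma thread_of_PosTest: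
  "thread_of M (Concat (Prim (PosTest a)) X) =
   pcc M (thread_of M X) a (thread_of M (Concat (Prim (Jump 2)) X))"
  using rec_suffix[OF suffix_Prim, of "PosTest a" X 1] thread_of_suffix[OF suffix_Prim, of "PosTest a" X]
    thread_of_Jump_Suc[of 1 X]
  by (simp add: thread_of_def rec_first instr_term_def numeral_2_eq_2)

lemma thread_of_NegTest:
  "thread_of M (Concat (Prim (NegTest a)) X) =
   pcc M (thread_of M (Concat (Prim (Jump 2)) X)) a (thread_of M X)"
  using rec_suffix[OF suffix_Prim, of "NegTest a" X 1] thread_of_suffix[OF suffix_Prim, of "NegTest a" X]
    thread_of_Jump_Suc[of 1 X]
  by (simp add: thread_of_def rec_first instr_term_def numeral_2_eq_2)

lemma thread_of_jump_chain:
  assumes "c 0 = 0" "\<And>n. \<exists>l. instr_at P (c n) = Jump l \<and> c (Suc n) = c n + l"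
  shows "thread_of M P = dead M"
proof -
  have "\<not> lands P (c n) j" for n j
  proof
    have "lands P i j \<Longrightarrow> i = c n \<Longrightarrow> False" for i n
    proof (induction arbitrary: n rule: lands.induct)
      case (here i) then show ?case using assms(2) by blast
    next
      case (jump i l j)
      then have "i + Suc l = c (Suc n)" using assms(2)[of n] by auto
      then show ?case using jump.IH by blast
    qed
    then show "lands P (c n) j \<Longrightarrow> False" by blast
  qed
  then have "\<not> lands P 0 j" for j using assms(1) by metis
  then show ?thesis using RDP[OF guarded_extr_spec extr_spec_none, of P 0]
    by (simp add: thread_of_def)
qed

end

end

theory Submission
  imports Defs
begin

text \<open>Every residual thread \<open>q\<close> of \<open>p\<close> gets a register of its own, and \<open>P\<close> sets the register
  of \<open>p\<close> and then repeats a body that contains one block of instructions for each residual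
  thread. The block of \<open>q\<close> has no effect unless the register of \<open>q\<close> is the one that is set;
  then it performs the first action of \<open>q\<close> and moves the mark to the register of the residual
  thread selected by the reply. Since a test skips just one instruction, each instruction of a
  block is guarded separately, and the reply is stored in registers meanwhile. The thread D has
  no instructions at all: if its register is set, the body is repeated without any external
  action. As the body also accesses \<open>sk\<close>, the outermost register, this divergence amounts to D.\<close>

section \<open>Instruction lists in front of PGA terms\<close>

definition prepend :: "'i list \<Rightarrow> 'i pga \<Rightarrow> 'i pga" where
  "prepend us X = foldr (\<lambda>u. Concat (Prim u)) us X"

lemma prepend_simps [simp]:
  "prepend [] X = X"
  "prepend (u # us) X = Concat (Prim u) (prepend us X)"
  "prepend (us @ vs) X = prepend us (prepend vs X)"
  by (simp_all add: prepend_def)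

lemma len_prepend: "len (prepend us X) = enat (length us) + len X"
  by (induction us) (simp_all add: enat_0 one_enat_def flip: add.assoc)

lemma instr_at_prepend:
  "instr_at (prepend us X) i = (if i < length us then us ! i else instr_at X (i - length us))"
  by (induction us arbitrary: i) (auto simp: one_enat_def nth_Cons split: nat.split)

lemma instrs_prepend [simp]: "instrs (prepend us X) = set us \<union> instrs X"
  by (induction us) auto

text \<open>Blocks may be empty but PGA terms may not, so the repeated body is a list closed by one
  instruction \<open>u\<close>. From the second round on, subtracting the body length does not
  change the position modulo that length.\<close>

lemma (in bta_model) thread_of_Repeat:
  "thread_of M (Repeat (prepend us (Prim u))) =
   thread_of M (prepend us (Concat (Prim u) (Repeat (prepend us (Prim u)))))"
proof (rule thread_of_same_sequence)
  fix i
  have "instr_at (prepend us (Prim u)) (i mod Suc (length us)) =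
      instr_at (prepend us (Prim u)) ((i - Suc (length us)) mod Suc (length us))"
    if "\<not> i < Suc (length us)"
    using that by (simp add: le_mod_geq)
  then show "instr_at (Repeat (prepend us (Prim u))) i =
      instr_at (prepend us (Concat (Prim u) (Repeat (prepend us (Prim u))))) i"
    by (auto simp: len_prepend instr_at_prepend one_enat_def)
qed (simp add: len_prepend)

lemma (in bta_model) thread_of_PosTest_skip:
  "thread_of M (Concat (Prim (PosTest a)) (Concat (Prim u) X)) =
   pcc M (thread_of M (Concat (Prim u) X)) a (thread_of M X)"
  using thread_of_Jump_skip[of 0 u X] thread_of_Jump_1[of X] 
  by (simp add: thread_of_PosTest numeral_2_eq_2)

section \<open>Boolean registers under the use operators\<close>

locale register_model = bta_model M for M :: "('f, 'm, reply + 's, 'p) bta" +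
  fixes set_T set_F get :: 'm
  assumes distinct_methods: "distinct [set_T, set_F, get]"
begin

definition reg :: "bool \<Rightarrow> ('m, reply + 's) service" where
  "reg b = bool_reg set_T set_F get (if b then ReplyT else ReplyF)"

lemma is_service_reg [simp]: "is_service (reg b)"
  by (simp add: reg_def is_service_bool_reg)

lemma use_reg [simp]:
  "use M f (stop M) (reg b) = stop M"
  "use M f (dead M) (reg b) = dead M"
  "f \<noteq> g \<Longrightarrow> use M f (pcc M x (g, m) y) (reg b) =
    pcc M (use M f x (reg b)) (g, m) (use M f y (reg b))"
  by (simp_all add: use_stop use_dead use_other)

text \<open>Effect and yield of a register coincide, so setting it to F also replies F and selects
  the right-hand thread.\<close>

lemma use_reg_set [simp]:
  "use M f (pcc M x (f, set_T) y) (reg b) = use M f x (reg True)"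
  "use M f (pcc M x (f, set_F) y) (reg b) = use M f y (reg False)"
proof -
  have "reply_of (reg b) set_T = ReplyT" "reply_of (reg b) set_F = ReplyF"
    "derived set_T (reg b) = reg True" "derived set_F (reg b) = reg False"
    using distinct_methods by (auto simp: reply_of_def derived_def reg_def bool_reg_def)
  then show "use M f (pcc M x (f, set_T) y) (reg b) = use M f x (reg True)"
    "use M f (pcc M x (f, set_F) y) (reg b) = use M f y (reg False)"
    by (simp_all add: use_T use_F)
qed

lemma use_reg_get [simp]:
  "use M f (pcc M x (f, get) y) (reg b) = use M f (if b then x else y) (reg b)"
proof -
  have "reply_of (reg b) get = (if b then ReplyT else ReplyF)" "derived get (reg b) = reg b"
    using distinct_methods by (auto simp: reply_of_def derived_def reg_def bool_reg_def)
  then show ?thesis by (cases b) (simp_all add: use_T use_F)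
qed

text \<open>Each projection of \<open>z\<close> consists of finitely many register actions ending in
  D, so it collapses to D; \<open>use_proj\<close> carries this over to \<open>z\<close>.\<close>

lemma use_reg_diverging:
  assumes "z = pcc M z (f, set_F) z"
  shows "use M f z (reg b) = dead M"
proof -
  have proj_dead': "proj M n (dead M) = dead M" for n
    by (cases n) (simp_all add: proj_0 proj_dead)
  have "use M f (proj M n z) (reg b) = dead M" for n b
  proof (induction n arbitrary: b)
    case (Suc n)
    have "proj M (Suc n) z = pcc M (proj M n z) (f, set_F) (proj M n z)"
      using assms proj_pcc by metis
    then show ?case using Suc by simp
  qed (simp add: proj_0)
  then have "use M f z (reg b) = use M f (dead M) (reg b)"
    by (intro use_proj[of _ f z "dead M"]) (simp_all add: proj_dead')
  then show ?thesis by simp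
qed

text \<open>The head of \<open>fs\<close> is the innermost operator.\<close>

definition use_regs :: "'f list \<Rightarrow> ('f \<Rightarrow> bool) \<Rightarrow> 'p \<Rightarrow> 'p" where
  "use_regs fs \<sigma> x = fold (\<lambda>f x. use M f x (reg (\<sigma> f))) fs x"

lemma use_regs_Cons: "use_regs (f # fs) \<sigma> x = use_regs fs \<sigma> (use M f x (reg (\<sigma> f)))"
  by (simp add: use_regs_def)

lemma use_regs_cong: "(\<And>f. f \<in> set fs \<Longrightarrow> \<sigma> f = \<tau> f) \<Longrightarrow> use_regs fs \<sigma> x = use_regs fs \<tau> x"
  unfolding use_regs_def by (rule fold_cong) auto

lemma use_regs_stop: "use_regs fs \<sigma> (stop M) = stop M"
  by (induction fs) (simp_all add: use_regs_def)

lemma use_regs_other: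
  "g \<notin> set fs \<Longrightarrow> use_regs fs \<sigma> (pcc M x (g, m) y) =
    pcc M (use_regs fs \<sigma> x) (g, m) (use_regs fs \<sigma> y)"
  by (induction fs arbitrary: x y) (auto simp: use_regs_def)

text \<open>Operators inside that of \<open>f\<close> let the action pass; by distinctness, those
  outside it do not see the change of \<sigma>.\<close>

lemma use_regs_set:
  assumes "distinct fs" "f \<in> set fs"
  shows "use_regs fs \<sigma> (pcc M x (f, set_T) y) = use_regs fs (\<sigma>(f := True)) x"
    and "use_regs fs \<sigma> (pcc M x (f, set_F) y) = use_regs fs (\<sigma>(f := False)) y"
  using assms
proof (induction fs arbitrary: x y)
  case (Cons h fs)
  { case 1
    then show ?case using Cons.IH(1)
      by (cases "h = f") (auto simp: use_regs_Cons intro: use_regs_cong)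
  next
    case 2
    then show ?case using Cons.IH(2)
      by (cases "h = f") (auto simp: use_regs_Cons intro: use_regs_cong) }
qed simp_all

lemma use_regs_get:
  assumes "distinct fs" "f \<in> set fs"
  shows "use_regs fs \<sigma> (pcc M x (f, get) y) = use_regs fs \<sigma> (if \<sigma> f then x else y)"
  using assms
proof (induction fs arbitrary: x y)
  case (Cons h fs)
  then show ?case by (cases "h = f") (simp_all add: use_regs_Cons)
qed simp

section \<open>Programs run against registers, and the block of one residual thread\<close>

definition run :: "'f list \<Rightarrow> ('f \<Rightarrow> bool) \<Rightarrow> ('f \<times> 'm) instr pga \<Rightarrow> 'p" where
  "run fs \<sigma> X = use_regs fs \<sigma> (thread_of M X)"

lemma run_set:
  assumes "distinct fs" "f \<in> set fs"
  shows "run fs \<sigma> (Concat (Prim (Basic (f, set_T))) X) = run fs (\<sigma>(f := True)) X"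
    and "run fs \<sigma> (Concat (Prim (Basic (f, set_F))) X) = run fs (\<sigma>(f := False)) X"
  using assms by (simp_all add: run_def thread_of_Basic use_regs_set)

lemma run_get:
  assumes "distinct fs" "f \<in> set fs"
  shows "run fs \<sigma> (Concat (Prim (PosTest (f, get))) (Concat (Prim u) X)) =
    (if \<sigma> f then run fs \<sigma> (Concat (Prim u) X) else run fs \<sigma> X)"
  using assms by (simp add: run_def thread_of_PosTest_skip use_regs_get)

lemma run_PosTest_other:
  assumes "fst a \<notin> set fs"
  shows "run fs \<sigma> (Concat (Prim (PosTest a)) (Concat (Prim u) X)) =
    pcc M (run fs \<sigma> (Concat (Prim u) X)) a (run fs \<sigma> X)"
  using assms by (cases a) (simp add: run_def thread_of_PosTest_skip use_regs_other)

lemma run_Halt: "run fs \<sigma> (Concat (Prim Halt) X) = stop M"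
  by (simp add: run_def thread_of_Halt use_regs_stop)

text \<open>At the beginning and at the end of a block, \<open>rt\<close> and \<open>rf\<close> hold F. If \<open>s\<close> holds T, then
  after the instructions up to the clearing of \<open>s\<close>, \<open>rt\<close> and \<open>rf\<close> tell whether the reply to \<open>a\<close>
  was T and F, respectively; otherwise both hold F. As \<open>s\<close> is cleared before \<open>s1\<close> or \<open>s2\<close> is
  set, these may be equal to \<open>s\<close>.\<close>

definition act_block :: "'f \<Rightarrow> 'f \<Rightarrow> 'f \<Rightarrow> 'f \<times> 'm \<Rightarrow> 'f \<Rightarrow> 'f \<Rightarrow> ('f \<times> 'm) instr list" where
  "act_block rt rf s a s1 s2 =
    [PosTest (s, get), Basic (rf, set_T),
     PosTest (s, get), PosTest a, Basic (rf, set_F),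
     PosTest (rf, get), Basic (s, set_F),
     PosTest (s, get), Basic (rt, set_T),
     Basic (s, set_F),
     PosTest (rt, get), Basic (s1, set_T),
     PosTest (rf, get), Basic (s2, set_T),
     Basic (rt, set_F), Basic (rf, set_F)]"

text \<open>Besides tests, only writes of F to registers that already hold F are executed.\<close>

lemma run_act_block_idle:
  assumes "distinct fs" "{rt, rf, s, s1, s2} \<subseteq> set fs" "\<not> \<sigma> s" "\<not> \<sigma> rt" "\<not> \<sigma> rf"
  shows "run fs \<sigma> (prepend (act_block rt rf s a s1 s2) X) = run fs \<sigma> X"
proof -
  have "\<sigma>(f := False) = \<sigma>" if "\<not> \<sigma> f" for f using that by (auto simp: fun_eq_iff)
  then show ?thesis using assms by (simp add: act_block_def run_get run_set)
qed

text \<open>As \<open>rf\<close> is set in advance, the one instruction after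
  \<open>PosTest a\<close> records the reply: T clears \<open>rf\<close>, F skips the clearing. On
  F, \<open>rf\<close> then clears \<open>s\<close>, so the next test of \<open>s\<close> sets
  \<open>rt\<close> only on reply T.\<close>

lemma run_act_block_active:
  assumes "distinct fs" "{rt, rf, s, s1, s2} \<subseteq> set fs" "fst a \<notin> set fs"
    and "rt \<noteq> rf" "rt \<notin> {s, s1, s2}" "rf \<notin> {s, s1, s2}"
  shows "run fs (\<lambda>f. f = s) (prepend (act_block rt rf s a s1 s2) X) =
    pcc M (run fs (\<lambda>f. f = s1) X) a (run fs (\<lambda>f. f = s2) X)"
proof -
  have "(\<lambda>f. f = s)(s := False, s1 := True, rt := False, rf := False) = (\<lambda>f. f = s1)"
    and "(\<lambda>f. f = s)(s := False, s2 := True, rt := False, rf := False) = (\<lambda>f. f = s2)"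
    using assms by (auto simp: fun_eq_iff)
  then show ?thesis using assms
    by (auto simp: act_block_def run_get run_set run_PosTest_other)
qed

end

section \<open>The looping program and its thread\<close>

theorem corollary1:
  fixes M :: "('f, 'm, reply + 's, 'p) bta"
    and st :: "nat \<Rightarrow> 'f" and rt rf en sk :: 'f
    and set_T set_F get :: 'm
    and p :: 'p
  assumes "bta_model M"
    and "distinct [set_T, set_F, get]"
    and "inj_on st {1..}"
    and "distinct [rt, rf, en, sk]"
    and "{rt, rf, en, sk} \<inter> st ` {1..} = {}"
    and "regular M p"
    and "thread_over M {(f, m). f \<notin> st ` {1..} \<union> {rt, rf, en, sk}} p"
  shows "\<exists>(n::nat) (P :: ('f \<times> 'm) instr pga). jump_free P \<and>
    (let BR_F = bool_reg set_T set_F get ReplyF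
     in p =
       use M sk
        (use M en
          (use M rf
            (use M rt
              (fold (\<lambda>j x. use M (st j) x BR_F) [1..<n + 3] (thread_of M P))
            BR_F)
          BR_F)
        BR_F)
       BR_F)"
proof -
  interpret register_model M set_T set_F get
    using assms(1,2) by (simp add: register_model_def register_model_axioms_def)
  let ?A = "{(f, m :: 'm). f \<notin> st ` {1..} \<union> {rt, rf, en, sk}}"
  have "finite (Res M p)" using assms(6) by (simp add: regular_def)
  then obtain qs where qs: "set qs = Res M p" "distinct qs"
    using finite_distinct_list by blast
  define n where "n = length qs"
  obtain h where h: "bij_betw h (Res M p) {0..<n}"
    using ex_bij_betw_finite_nat[OF \<open>finite (Res M p)\<close>] qs by (metis distinct_card n_def)
  \<comment> \<open>\<open>h\<close> counts from 0 and the foci \<open>st\<close> from 1, hence the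
    \<open>Suc\<close>.\<close>
  define r where "r q = st (Suc (h q))" for q
  have r_eq: "r q = r q' \<longleftrightarrow> q = q'" if "q \<in> Res M p" "q' \<in> Res M p" for q q'
    using that h assms(3) by (auto simp: r_def bij_betw_def inj_on_def)
  have r_neq: "r q \<noteq> rt" "r q \<noteq> rf" "r q \<noteq> en" "r q \<noteq> sk" for q
    using assms(5) by (auto simp: r_def)
  \<comment> \<open>\<open>sk\<close> is kept apart: the divergence argument first applies all other
    registers, leaving the \<open>sk\<close> actions visible.\<close>
  define fs where "fs = map st [1..<n + 3] @ [rt, rf, en]"
  have dist: "distinct (fs @ [sk])"
    using assms(3-5) by (auto simp: fs_def distinct_map intro: inj_on_subset)
  have sk: "sk \<notin> set fs" using dist by simp
  have r_fs: "r q \<in> set fs" if "q \<in> Res M p" for q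
  proof -
    have "h q < n" using h that by (auto simp: bij_betw_def)
    then show ?thesis by (auto simp: r_def fs_def)
  qed
  have A: "fst a \<notin> set (fs @ [sk])" if "a \<in> ?A" for a
    using that by (auto simp: fs_def)

  have "\<exists>x a y. q = dead M \<or> q = stop M \<or> (a \<in> ?A \<and> q = pcc M x a y)" if "q \<in> Res M p" for q
    using assms(7) that unfolding thread_over_def by blast
  \<comment> \<open>Choice fixes one decomposition per residual thread; the axioms do not make it
    unique.\<close>
  then obtain x a y where dec:
    "\<And>q. q \<in> Res M p \<Longrightarrow> q = dead M \<or> q = stop M \<or> (a q \<in> ?A \<and> q = pcc M (x q) (a q) (y q))"
    by metis
  define block where "block q =
    (if q = dead M then [] else if q = stop M then [PosTest (r q, get), Halt]
     else act_block rt rf (r q) (a q) (r (x q)) (r (y q)))" for q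
  have succ: "a q \<in> ?A" "q = pcc M (x q) (a q) (y q)" "x q \<in> Res M p" "y q \<in> Res M p"
    if "q \<in> Res M p" "q \<noteq> dead M" "q \<noteq> stop M" for q
    using dec[OF that(1)] that Res.left[of M "x q" "a q" "y q" p]
      Res.right[of M "x q" "a q" "y q" p] by auto

  define u where "u = Basic (sk, set_F)"
  define blocks where "blocks ws = concat (map block ws)" for ws
  define Loop where "Loop = Repeat (prepend (blocks qs) (Prim u))"
  \<comment> \<open>What remains of the current round when the blocks of \<open>ws\<close> are still
    ahead, followed by all later rounds.\<close>
  define rest where "rest ws = prepend (blocks ws) (Concat (Prim u) Loop)" for ws
  have rest_Cons: "rest (q # ws) = prepend (block q) (rest ws)" for q ws
    by (simp add: rest_def blocks_def)
  have Loop: "run gs \<sigma> Loop = run gs \<sigma> (rest qs)" for gs \<sigma>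
    unfolding run_def Loop_def rest_def thread_of_Repeat ..

  have idle: "run gs (\<lambda>f. f = r q) (prepend (block q') X) = run gs (\<lambda>f. f = r q) X"
    if "distinct gs" "set fs \<subseteq> set gs" "q \<in> Res M p" "q' \<in> Res M p" "q' \<noteq> q" for gs q q' X
  proof -
    have "r q' \<noteq> r q" using that r_eq by simp
    moreover have "rt \<in> set gs" "rf \<in> set gs" using that(2) by (auto simp: fs_def)
    moreover have "r w \<in> set gs" if "w \<in> Res M p" for w
      using r_fs[OF that] \<open>set fs \<subseteq> set gs\<close> by blast
    ultimately show ?thesis using that r_neq[symmetric] succ(3,4)[of q']
      by (auto simp: block_def run_get intro!: run_act_block_idle)
  qed
  have idle_blocks: "run gs (\<lambda>f. f = r q) (rest (vs @ ws)) = run gs (\<lambda>f. f = r q) (rest ws)"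
    if "distinct gs" "set fs \<subseteq> set gs" "q \<in> Res M p" "set vs \<subseteq> Res M p" "q \<notin> set vs"
    for gs q vs ws
    using that(4,5) by (induction vs) (auto simp: rest_Cons idle[OF that(1-3)])

  define V where "V q = run (fs @ [sk]) (\<lambda>f. f = r q) Loop" for q
  \<comment> \<open>The position within a round does not matter: either the block of
    \<open>q\<close> is still ahead and the blocks passed are idle for it, or the remaining blocks
    are idle and the next round starts.\<close>
  have V_rest: "run (fs @ [sk]) (\<lambda>f. f = r q) (rest ws) = V q"
    if "q \<in> Res M p" "qs = vs @ ws" for q vs ws
  proof (cases "q \<in> set ws")
    case True
    then have "q \<notin> set vs" "set vs \<subseteq> Res M p" using qs that by auto
    then show ?thesis
      using idle_blocks[of "fs @ [sk]" q vs ws] dist that by (simp add: V_def Loop subset_insertI)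
  next
    case False
    have "(\<lambda>f. f = r q)(sk := False) = (\<lambda>f. f = r q)" using r_neq[of q] by (auto simp: fun_eq_iff)
    then have "run (fs @ [sk]) (\<lambda>f. f = r q) (rest []) = V q"
      using dist by (simp add: rest_def blocks_def u_def run_set V_def del: distinct_append)
    then show ?thesis
      using False idle_blocks[of "fs @ [sk]" q ws "[]"] dist that qs by auto
  qed
  have V_dead: "V (dead M) = dead M" if dead: "dead M \<in> Res M p"
  proof -
    let ?\<sigma> = "\<lambda>f. f = r (dead M)"
    obtain vs ws where qs_split: "qs = vs @ dead M # ws" 
      using split_list dead qs(1) by metis
    \<comment> \<open>Without the operator for \<open>sk\<close>, a full round reduces to the action
      of \<open>u\<close>, so this thread solves \<open>z = pcc M z (sk, set_F) z\<close>.\<close>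
    have "run fs ?\<sigma> Loop = run fs ?\<sigma> (rest (dead M # ws))"
      using idle_blocks[of fs "dead M" vs] dist dead qs qs_split by (auto simp: Loop)
    also have "\<dots> = run fs ?\<sigma> (rest (ws @ []))" by (simp add: rest_Cons block_def)
    also have "\<dots> = run fs ?\<sigma> (rest [])"
      using dead qs qs_split dist by (intro idle_blocks) auto
    also have "\<dots> = pcc M (run fs ?\<sigma> Loop) (sk, set_F) (run fs ?\<sigma> Loop)"
      using sk by (simp add: rest_def blocks_def u_def run_def thread_of_Basic use_regs_other)
    finally show ?thesis
      using use_reg_diverging by (simp add: V_def run_def use_regs_def)
  qed
  have V_step: "V q = stop M \<and> q = stop M \<or> q = pcc M (x q) (a q) (y q) \<and>
      V q = pcc M (V (x q)) (a q) (V (y q)) \<and> x q \<in> Res M p \<and> y q \<in> Res M p"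
    if q: "q \<in> Res M p" "q \<noteq> dead M" for q
  proof -
    obtain vs ws where qs_split: "qs = vs @ q # ws" 
      using split_list q(1) qs(1) by metis
    have Vq: "V q = run (fs @ [sk]) (\<lambda>f. f = r q) (prepend (block q) (rest ws))"
      using V_rest[OF q(1) qs_split] by (simp add: rest_Cons)
    show ?thesis
    proof (cases "q = stop M")
      case True
      then have "V q = stop M"
        using Vq q r_fs[OF q(1)] dist
        by (simp add: block_def run_get run_Halt del: distinct_append)
      with True show ?thesis by simp
    next
      case False
      note s = succ[OF q False]
      have "V q = pcc M (run (fs @ [sk]) (\<lambda>f. f = r (x q)) (rest ws)) (a q)
          (run (fs @ [sk]) (\<lambda>f. f = r (y q)) (rest ws))"
        unfolding Vq block_def if_not_P[OF q(2)] if_not_P[OF False]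
        using A[OF s(1)] r_fs[OF q(1)] r_fs[OF s(3)] r_fs[OF s(4)] r_neq[symmetric] dist assms(4)
        by (intro run_act_block_active) (auto simp: fs_def)
      then show ?thesis
        using V_rest[OF s(3), of "vs @ [q]" ws] V_rest[OF s(4), of "vs @ [q]" ws] qs_split s
        by simp
    qed
  qed
  \<comment> \<open>\<open>V\<close> and the identity satisfy the same equations on the residual
    threads, so induction on the depth treats all of them at once.\<close>
  have "proj M k (V q) = proj M k q" if "q \<in> Res M p" for k q
    using that
  proof (induction k arbitrary: q)
    case (Suc k)
    show ?case
    proof (cases "q = dead M")
      case False
      then show ?thesis using V_step[OF Suc.prems False] Suc.IH by (metis proj_pcc)
    qed (use V_dead Suc.prems in simp)
  qed (simp add: proj_0)
  then have "proj M k (V p) = proj M k p" for k by (simp add: Res.self)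
  then have "V p = p" by (rule AIP)

  define P where "P = Concat (Prim (Basic (r p, set_T))) Loop"
  have "(\<lambda>f. False)(r p := True) = (\<lambda>f. f = r p)" by (auto simp: fun_eq_iff)
  then have "run (fs @ [sk]) (\<lambda>f. False) P = p"
    using \<open>V p = p\<close> r_fs[OF Res.self] dist
    by (simp add: P_def V_def run_set del: distinct_append)
  then have "p = use M sk (use M en (use M rf (use M rt
      (fold (\<lambda>j x. use M (st j) x (reg False)) [1..<n + 3] (thread_of M P))
      (reg False)) (reg False)) (reg False)) (reg False)"
    by (simp add: run_def use_regs_def fs_def fold_map comp_def del: upt_Suc)
  moreover have "jump_free P"
    by (auto simp: jump_free_def P_def Loop_def u_def blocks_def block_def act_block_def
        split: if_splits)
  ultimately show ?thesis unfolding Let_def reg_def by auto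
qed

end
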